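(* Let $P,Q,b_0,b_1\in\mathbb C$ and let $x,y,z:\mathbb Z^2\to\mathbb C$ satisfy the C3 lattice system at every lattice point: $$y_{1,0}z_{0,0}=x_{1,0}-x_{0,0},\qquad y_{0,1}z_{0,0}=x_{0,1}-x_{0,0},$$ $$z_{1,1}y_{0,0}=b_0x_{0,0}+b_1+z_{0,0}\,\frac{P\,y_{1,0}z_{0,1}-Q\,y_{0,1}z_{1,0}}{z_{1,0}-z_{0,1}},$$ where $y$ and $z$ vanish nowhere and $z_{1,0}\ne z_{0,1}$, $x_{1,0}\neq x_{0,1}$ at every lattice point. Then $x$ satisfies, at every lattice point, $$\frac{(x_{2,2}-x_{1,2})(x_{0,2}-x_{1,1})(x_{0,1}-x_{0,0})}{(x_{2,2}-x_{2,1})(x_{1,1}-x_{2,0})(x_{1,0}-x_{0,0})}=\frac{N_1}{N_2},$$ where $$N_1=(x_{1,1}-x_{0,2})(b_0x_{0,1}+b_1)+(x_{1,2}-x_{0,2})(x_{0,1}-x_{1,1})P-(x_{1,2}-x_{1,1})(x_{0,1}-x_{0,2})Q,$$ $$N_2=(x_{2,0}-x_{1,1})(b_0x_{1,0}+b_1)+(x_{2,1}-x_{1,1})(x_{1,0}-x_{2,0})P-(x_{2,1}-x_{2,0})(x_{1,0}-x_{1,1})Q .$$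
   Context: For a function $u$ on $\mathbb Z^2$ and a generic base point $(n,m)$, $u_{\nu,\mu}$ denotes $u(n+\nu,m+\mu)$; an equation "holds at every lattice point" if it holds for every $(n,m)\in\mathbb Z^2$. *)

theory Defs
  imports Complex_Main
begin

definition C3_system_at ::
    "complex \<Rightarrow> complex \<Rightarrow> complex \<Rightarrow> complex \<Rightarrow>
     (int \<Rightarrow> int \<Rightarrow> complex) \<Rightarrow> (int \<Rightarrow> int \<Rightarrow> complex) \<Rightarrow> (int \<Rightarrow> int \<Rightarrow> complex) \<Rightarrow>
     int \<Rightarrow> int \<Rightarrow> bool" where
  "C3_system_at P Q b0 b1 x y z n m \<longleftrightarrow>
     y (n+1) m * z n m = x (n+1) m - x n m \<and>
     y n (m+1) * z n m = x n (m+1) - x n m \<and>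
     z (n+1) (m+1) * y n m =
       b0 * x n m + b1 +
       z n m * ((P * y (n+1) m * z n (m+1) - Q * y n (m+1) * z (n+1) m)
                / (z (n+1) m - z n (m+1)))"

definition N1 ::
    "complex \<Rightarrow> complex \<Rightarrow> complex \<Rightarrow> complex \<Rightarrow>
     (int \<Rightarrow> int \<Rightarrow> complex) \<Rightarrow> int \<Rightarrow> int \<Rightarrow> complex" where
  "N1 P Q b0 b1 x n m =
     (x (n+1) (m+1) - x n (m+2)) * (b0 * x n (m+1) + b1)
     + (x (n+1) (m+2) - x n (m+2)) * (x n (m+1) - x (n+1) (m+1)) * P
     - (x (n+1) (m+2) - x (n+1) (m+1)) * (x n (m+1) - x n (m+2)) * Q"

definition N2 ::
    "complex \<Rightarrow> complex \<Rightarrow> complex \<Rightarrow> complex \<Rightarrow>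
     (int \<Rightarrow> int \<Rightarrow> complex) \<Rightarrow> int \<Rightarrow> int \<Rightarrow> complex" where
  "N2 P Q b0 b1 x n m =
     (x (n+2) m - x (n+1) (m+1)) * (b0 * x (n+1) m + b1)
     + (x (n+2) (m+1) - x (n+1) (m+1)) * (x (n+1) m - x (n+2) m) * P
     - (x (n+2) (m+1) - x (n+2) m) * (x (n+1) m - x (n+1) (m+1)) * Q"

end

theory Submission
  imports Defs
begin

text \<open>The first two equations, based at \<open>(n+1, m)\<close> and \<open>(n, m+1)\<close>, give
  \<open>y\<^sub>1\<^sub>1 z\<^sub>1\<^sub>0 = x\<^sub>1\<^sub>1 - x\<^sub>1\<^sub>0\<close> and \<open>y\<^sub>1\<^sub>1 z\<^sub>0\<^sub>1 = x\<^sub>1\<^sub>1 - x\<^sub>0\<^sub>1\<close>, so the ratios of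
  \<open>z\<^sub>1\<^sub>0\<close>, \<open>z\<^sub>0\<^sub>1\<close> and \<open>z\<^sub>1\<^sub>0 - z\<^sub>0\<^sub>1\<close> in the third equation depend on \<open>x\<close> only. The resulting
  right-hand side is \<open>N1\<close> when based at \<open>(n, m+1)\<close> and \<open>N2\<close> when based at \<open>(n+1, m)\<close>; in
  \<open>N1 / N2\<close> the remaining factors \<open>z y\<close> are again quotients of differences of \<open>x\<close>.\<close>

lemma C3_system_atD:
  assumes "C3_system_at P Q b0 b1 x y z n m"
  shows "y (n+1) m * z n m = x (n+1) m - x n m"
    and "y n (m+1) * z n m = x n (m+1) - x n m"
    and "z (n+1) (m+1) * y n m = b0 * x n m + b1 +
       z n m * ((P * y (n+1) m * z n (m+1) - Q * y n (m+1) * z (n+1) m)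
                / (z (n+1) m - z n (m+1)))"
  using assms by (auto simp: C3_system_at_def)

text \<open>The factor \<open>x (n+1) m - x n (m+1)\<close> is \<open>- y (n+1) (m+1)\<close> times
  the denominator in the third equation, so multiplying by it clears the fraction and leaves only
  \<open>x\<close> on the right.\<close>

lemma C3_third_equation_eliminated:
  assumes system: "\<And>n m. C3_system_at P Q b0 b1 x y z n m"
    and z_neq: "z (n+1) m \<noteq> z n (m+1)"
  shows "z (n+1) (m+1) * y n m * (x (n+1) m - x n (m+1)) =
     (x (n+1) m - x n (m+1)) * (b0 * x n m + b1)
     + (x (n+1) (m+1) - x n (m+1)) * (x n m - x (n+1) m) * P
     - (x (n+1) (m+1) - x (n+1) m) * (x n m - x n (m+1)) * Q"
proof -
  let ?Y = "y (n+1) (m+1)" and ?d = "z (n+1) m - z n (m+1)"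
  note eqs = C3_system_atD[OF system, of n m]
  have h10: "x (n+1) (m+1) - x (n+1) m = ?Y * z (n+1) m"
    using C3_system_atD(2)[OF system, of "n+1" m] by simp
  have h01: "x (n+1) (m+1) - x n (m+1) = ?Y * z n (m+1)"
    using C3_system_atD(1)[OF system, of n "m+1"] by simp
  have diff: "x (n+1) m - x n (m+1) = - ?Y * ?d"
    using h10 h01 by (simp add: algebra_simps)
  have P_factor: "x n m - x (n+1) m = - (y (n+1) m * z n m)"
    and Q_factor: "x n m - x n (m+1) = - (y n (m+1) * z n m)"
    using eqs(1,2) by simp_all
  have "?d \<noteq> 0"
    using z_neq by simp
  then have "z (n+1) (m+1) * y n m * ?d = (b0 * x n m + b1) * ?d
      + z n m * (P * y (n+1) m * z n (m+1) - Q * y n (m+1) * z (n+1) m)"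
    by (simp add: eqs(3) distrib_right)
  then have "z (n+1) (m+1) * y n m * (- ?Y * ?d) = (- ?Y * ?d) * (b0 * x n m + b1)
      + (?Y * z n (m+1)) * (- (y (n+1) m * z n m)) * P
      - (?Y * z (n+1) m) * (- (y n (m+1) * z n m)) * Q"
    by algebra
  then show ?thesis
    by (simp only: diff h10 h01 P_factor Q_factor)
qed

theorem mainTheorem3:
  fixes P Q b0 b1 :: complex
    and x y z :: "int \<Rightarrow> int \<Rightarrow> complex"
  assumes system: "\<And>n m. C3_system_at P Q b0 b1 x y z n m"
    and y_nonzero: "\<And>n m. y n m \<noteq> 0"
    and z_nonzero: "\<And>n m. z n m \<noteq> 0"
    and z_neq: "\<And>n m. z (n+1) m \<noteq> z n (m+1)"
    and x_neq: "\<And>n m. x (n+1) m \<noteq> x n (m+1)"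
  shows "\<forall>n m.
    (x (n+2) (m+2) - x (n+2) (m+1)) * (x (n+1) (m+1) - x (n+2) m) * (x (n+1) m - x n m) \<noteq> 0 \<and>
    N2 P Q b0 b1 x n m \<noteq> 0 \<and>
    ((x (n+2) (m+2) - x (n+1) (m+2)) * (x n (m+2) - x (n+1) (m+1)) * (x n (m+1) - x n m))
      / ((x (n+2) (m+2) - x (n+2) (m+1)) * (x (n+1) (m+1) - x (n+2) m) * (x (n+1) m - x n m))
    = N1 P Q b0 b1 x n m / N2 P Q b0 b1 x n m"
proof (intro allI conjI)
  fix n m
  have N1: "N1 P Q b0 b1 x n m = z (n+1) (m+2) * y n (m+1) * (x (n+1) (m+1) - x n (m+2))"
    using C3_third_equation_eliminated[where y = y and z = z and n = n and m = "m+1", OF system z_neq]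
    by (simp add: N1_def add.assoc)
  have N2: "N2 P Q b0 b1 x n m = z (n+2) (m+1) * y (n+1) m * (x (n+2) m - x (n+1) (m+1))"
    using C3_third_equation_eliminated[where y = y and z = z and n = "n+1" and m = m, OF system z_neq]
    by (simp add: N2_def add.assoc)
  have h: "x (n+1) m - x n m = y (n+1) m * z n m" "x n (m+1) - x n m = y n (m+1) * z n m"
    using C3_system_atD(1,2)[OF system, of n m] by simp_all
  \<comment> \<open>The \<open>z\<close> factors here are those of \<open>N1\<close> and
    \<open>N2\<close>; the common \<open>y (n+2) (m+2)\<close> cancels in the quotient.\<close>
  have k: "x (n+2) (m+2) - x (n+1) (m+2) = y (n+2) (m+2) * z (n+1) (m+2)"
    "x (n+2) (m+2) - x (n+2) (m+1) = y (n+2) (m+2) * z (n+2) (m+1)"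
    using C3_system_atD(1)[OF system, of "n+1" "m+2"]
      C3_system_atD(2)[OF system, of "n+2" "m+1"] by (simp_all add: add.assoc)
  have d: "x (n+2) m - x (n+1) (m+1) \<noteq> 0"
    using x_neq[of "n+1" m] by (simp add: add.assoc)
  show den: "(x (n+2) (m+2) - x (n+2) (m+1)) * (x (n+1) (m+1) - x (n+2) m) * (x (n+1) m - x n m) \<noteq> 0"
    unfolding h k using d y_nonzero z_nonzero by simp
  show N2_nonzero: "N2 P Q b0 b1 x n m \<noteq> 0"
    unfolding N2 using d y_nonzero z_nonzero by simp
  show "((x (n+2) (m+2) - x (n+1) (m+2)) * (x n (m+2) - x (n+1) (m+1)) * (x n (m+1) - x n m))
      / ((x (n+2) (m+2) - x (n+2) (m+1)) * (x (n+1) (m+1) - x (n+2) m) * (x (n+1) m - x n m))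
    = N1 P Q b0 b1 x n m / N2 P Q b0 b1 x n m"
    \<comment> \<open>Cross-multiplied, both sides are the same product up to two reversed
      differences of \<open>x\<close>, whose signs cancel.\<close>
    unfolding frac_eq_eq[OF den N2_nonzero] unfolding N1 N2 h k by algebra
qed

end
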